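(* Let $\lambda=(\lambda_1>\lambda_2>\cdots>\lambda_\ell>0)$ be a partition with distinct parts, let $o$ be the number of odd parts of $\lambda$ and $e$ the number of even parts of $\lambda$, and let $\ell(\lambda)=\ell$. Then $$\mathrm{srank}(\lambda)=\max\bigl(o,\; e+(\ell(\lambda)\bmod 2)\bigr),$$ where $a \bmod 2$ denotes $1$ if $a$ is odd and $0$ if $a$ is even.
   Context: For a partition $\lambda$ with distinct parts of length $\ell$, the shifted diagram $S(\lambda)$ has $\ell$ rows, row $i$ consisting of $\lambda_i$ squares, the first square of row $i$ (for $i>1$) placed under the second square of row $i-1$. For an odd positive integer $r$ (put $\lambda_{\ell+1}=0$), the $r$-bars of $\lambda$ are: (type 1) for a row $i$ such that $\lambda_{j+1}<\lambda_i-r<\lambda_j$ for some $j\le \ell$, the rightmost $r$ squares of row $i$; removing them gives the strict partition obtained by deleting $\lambda_i$ and inserting $\lambda_i-r$ in its sorted position; (type 2) for a row $i$ with $\lambda_i=r$, the whole row $i$; removing it deletes the part $\lambda_i$; (type 3) for rows $i<j$ with $\lambda_i+\lambda_j=r$, all squares of rows $i$ and $j$; removing it deletes both parts. A bar tableau of shape $\lambda$ is an assignment of positive integers to the squares of $S(\lambda)$ such that either $\lambda$ is empty, or the set of squares carrying the largest integer is an $r$-bar (for some odd $r$) and, after removing this bar and reordering the remaining (relabelled-in-place) rows so that they form the shifted diagram of the resulting strict partition (a shortened row keeping its remaining leftmost entries), the result is a bar tableau. Each label thus occupies exactly one bar; the number of bars of a bar tableau is the number of distinct labels. The shifted rank $\mathrm{srank}(\lambda)$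 is the minimum number of bars in a bar tableau of shape $\lambda$. *)

theory Defs
  imports Main
begin

text \<open>
  A partition with distinct parts is the strictly decreasing list of its parts. Rows and columns
  are numbered from 0, so row \<open>i\<close> of the shifted diagram starts in column \<open>i\<close>.
\<close>

definition strict_partition :: "nat list \<Rightarrow> bool" where
  "strict_partition la \<longleftrightarrow> sorted_wrt (>) la \<and> (\<forall>p\<in>set la. 0 < p)"

text \<open>The convention that the part following the last one is 0.\<close>

definition part :: "nat list \<Rightarrow> nat \<Rightarrow> nat" where
  "part la i = (if i < length la then la ! i else 0)"

definition row_squares :: "nat list \<Rightarrow> nat \<Rightarrow> (nat \<times> nat) set" where
  "row_squares la i = {(i, k) | k. i \<le> k \<and> k < i + la ! i}"

definition shifted_diagram :: "nat list \<Rightarrow> (nat \<times> nat) set" where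
  "shifted_diagram la = (\<Union>i<length la. row_squares la i)"

text \<open>
  In type 1 the condition on \<open>la ! i - r\<close> is written additively to avoid truncated subtraction;
  it forces \<open>r < la ! i\<close>.
\<close>

inductive is_bar :: "nat list \<Rightarrow> nat \<Rightarrow> (nat \<times> nat) set \<Rightarrow> bool" for la :: "nat list" and r :: nat where
  type1: "is_bar la r {(i, k) | k. i + (la ! i - r) \<le> k \<and> k < i + la ! i}"
    if "odd r" "i < length la" "j < length la" "part la (Suc j) + r < la ! i" "la ! i < la ! j + r"
| type2: "is_bar la r (row_squares la i)"
    if "odd r" "i < length la" "la ! i = r"
| type3: "is_bar la r (row_squares la i \<union> row_squares la j)"
    if "odd r" "i < j" "j < length la" "la ! i + la ! j = r"

text \<open>
  Removal of a bar: \<open>rows_left\<close> lists the old indices of the nonempty remaining rows in the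
  order (decreasing length) in which they form the new diagram. Row \<open>p\<close> of the new filling carries
  the leftmost entries of the old row \<open>rows_left la B ! p\<close>.
  The lemmas \<open>set_remove_bar_type1\<close> to \<open>set_remove_bar_type3\<close> and \<open>strict_partition_remove_bar\<close>
  below identify the new shape for each type of bar.
\<close>

definition row_left :: "nat list \<Rightarrow> (nat \<times> nat) set \<Rightarrow> nat \<Rightarrow> nat" where
  "row_left la B i = card (row_squares la i - B)"

definition rows_left :: "nat list \<Rightarrow> (nat \<times> nat) set \<Rightarrow> nat list" where
  "rows_left la B =
     rev (sort_key (row_left la B) (filter (\<lambda>i. 0 < row_left la B i) [0..<length la]))"

definition remove_bar :: "nat list \<Rightarrow> (nat \<times> nat) set \<Rightarrow> nat list" where
  "remove_bar la B = map (row_left la B) (rows_left la B)"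

definition remove_filling ::
    "nat list \<Rightarrow> (nat \<times> nat) set \<Rightarrow> (nat \<times> nat \<Rightarrow> nat) \<Rightarrow> (nat \<times> nat \<Rightarrow> nat)" where
  "remove_filling la B T =
     (\<lambda>(p, k). T (rows_left la B ! p, rows_left la B ! p + (k - p)))"

text \<open>Only the values of the filling \<open>T\<close> on the squares of the diagram matter.\<close>

inductive bar_tableau :: "nat list \<Rightarrow> (nat \<times> nat \<Rightarrow> nat) \<Rightarrow> bool" where
  empty: "bar_tableau [] T"
| step: "bar_tableau la T"
    if "la \<noteq> []"
       "\<forall>s\<in>shifted_diagram la. 0 < T s"
       "B = {s \<in> shifted_diagram la. T s = Max (T ` shifted_diagram la)}"
       "is_bar la r B"
       "bar_tableau (remove_bar la B) (remove_filling la B T)"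

definition num_bars :: "nat list \<Rightarrow> (nat \<times> nat \<Rightarrow> nat) \<Rightarrow> nat" where
  "num_bars la T = card (T ` shifted_diagram la)"

definition srank :: "nat list \<Rightarrow> nat" where
  "srank la = (LEAST n. \<exists>T. bar_tableau la T \<and> num_bars la T = n)"

lemma row_left_type1:
  assumes "r \<le> la ! i"
  shows "row_left la {(i, k) | k. i + (la ! i - r) \<le> k \<and> k < i + la ! i} i' =
    (if i' = i then la ! i - r else la ! i')"
proof -
  have "row_squares la i' - {(i, k) | k. i + (la ! i - r) \<le> k \<and> k < i + la ! i} =
    Pair i' ` {i'..<i' + (if i' = i then la ! i - r else la ! i')}"
    using assms by (auto simp: row_squares_def)
  then show ?thesis
    by (simp add: row_left_def card_image inj_on_def)
qed

lemma row_left_rows: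
  "row_left la (\<Union>i\<in>I. row_squares la i) i' = (if i' \<in> I then 0 else la ! i')"
proof -
  have "row_squares la i' - (\<Union>i\<in>I. row_squares la i) =
    Pair i' ` {i'..<i' + (if i' \<in> I then 0 else la ! i')}"
    by (auto simp: row_squares_def)
  then show ?thesis
    by (simp add: row_left_def card_image inj_on_def)
qed

lemma row_left_type2:
  "row_left la (row_squares la i) i' = (if i' = i then 0 else la ! i')"
  using row_left_rows[of la "{i}" i'] by simp

lemma row_left_type3:
  "row_left la (row_squares la i \<union> row_squares la j) i' = (if i' = i \<or> i' = j then 0 else la ! i')"
  using row_left_rows[of la "{i, j}" i'] by simp

lemma set_remove_bar:
  "set (remove_bar la B) = row_left la B ` {..<length la} - {0}"
  by (auto simp: remove_bar_def rows_left_def)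

lemma strict_partition_nth_eq_iff:
  assumes "strict_partition la" "i < length la" "j < length la"
  shows "la ! i = la ! j \<longleftrightarrow> i = j"
  using assms unfolding strict_partition_def sorted_wrt_iff_nth_less
  by (metis less_irrefl linorder_neqE_nat)

lemma strict_partition_nth_pos:
  "strict_partition la \<Longrightarrow> i < length la \<Longrightarrow> 0 < la ! i"
  by (simp add: strict_partition_def)

lemma strict_partition_set_drop:
  assumes "strict_partition la" "I \<subseteq> {..<length la}"
  shows "set la - (\<lambda>i. la ! i) ` I = (\<lambda>i. la ! i) ` ({..<length la} - I)"
  using strict_partition_nth_eq_iff[OF assms(1)] assms(2)
  by (fastforce simp: in_set_conv_nth)

lemma type1_notin:
  assumes "strict_partition la" "j < length la"
    "part la (Suc j) + r < la ! i" "la ! i < la ! j + r" "k < length la"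
  shows "la ! k \<noteq> la ! i - r"
proof (cases "k \<le> j")
  case True
  then have "la ! j \<le> la ! k"
    using assms unfolding strict_partition_def sorted_wrt_iff_nth_less
    by (metis le_neq_implies_less less_imp_le order_refl)
  then show ?thesis using assms(3,4) by linarith
next
  case False
  then have k: "k = Suc j \<or> Suc j < k" by linarith
  then have "la ! k \<le> la ! Suc j"
    using assms(1,5) unfolding strict_partition_def sorted_wrt_iff_nth_less
    by (auto intro: less_imp_le)
  then have "la ! k \<le> part la (Suc j)"
    using k assms(5) by (auto simp: part_def)
  then show ?thesis using assms(3,4) by linarith
qed

lemma set_remove_bar_general:
  assumes la: "strict_partition la" and I: "I \<subseteq> {..<length la}"
    and eq: "\<And>k. row_left la B k = (if k \<in> I then c else la ! k)"
  shows "set (remove_bar la B) = ((\<lambda>_. c) ` I - {0}) \<union> (set la - (\<lambda>i. la ! i) ` I)"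
proof -
  let ?J = "{..<length la} - I"
  have "{..<length la} = I \<union> ?J"
    using I by blast
  then have "row_left la B ` {..<length la} = row_left la B ` I \<union> row_left la B ` ?J"
    by (metis image_Un)
  also have "row_left la B ` I = (\<lambda>_. c) ` I"
    by (rule image_cong) (simp_all add: eq)
  also have "row_left la B ` ?J = (\<lambda>i. la ! i) ` ?J"
    by (rule image_cong) (simp_all add: eq)
  also have "\<dots> = set la - (\<lambda>i. la ! i) ` I"
    using strict_partition_set_drop[OF la I] by simp
  finally have "set (remove_bar la B) =
      ((\<lambda>_. c) ` I \<union> (set la - (\<lambda>i. la ! i) ` I)) - {0}"
    by (simp only: set_remove_bar)
  moreover have "0 \<notin> set la"
    using la by (auto simp: strict_partition_def)
  ultimately show ?thesis by blast
qed

lemma set_remove_bar_type1: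
  assumes "strict_partition la" "i < length la" "part la (Suc j) + r < la ! i"
  shows "set (remove_bar la {(i, k) | k. i + (la ! i - r) \<le> k \<and> k < i + la ! i}) =
    insert (la ! i - r) (set la - {la ! i})"
  using set_remove_bar_general[OF assms(1), of "{i}" _ "la ! i - r"] row_left_type1[of r la i]
    assms(2,3)
  by simp

lemma set_remove_bar_type2:
  assumes "strict_partition la" "i < length la"
  shows "set (remove_bar la (row_squares la i)) = set la - {la ! i}"
  using set_remove_bar_general[OF assms(1), of "{i}" _ 0] row_left_type2[of la i] assms(2)
  by simp

lemma set_remove_bar_type3:
  assumes "strict_partition la" "i < j" "j < length la"
  shows "set (remove_bar la (row_squares la i \<union> row_squares la j)) = set la - {la ! i, la ! j}"
  using set_remove_bar_general[OF assms(1), of "{i, j}" _ 0] row_left_type3[of la i j] assms(2,3)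
  by simp

lemma strict_partition_remove_bar:
  assumes la: "strict_partition la" and B: "is_bar la r B"
  shows "strict_partition (remove_bar la B)"
proof -
  have inj: "inj_on (row_left la B) {i. i < length la \<and> 0 < row_left la B i}"
    using B
  proof cases
    case (type1 i j)
    have eq: "row_left la B k = (if k = i then la ! i - r else la ! k)" for k
      using row_left_type1[of r la i k] type1 by simp
    have notin: "la ! k \<noteq> la ! i - r" if "k < length la" for k
      using type1_notin[OF la type1(4,5,6) that] .
    show ?thesis
    proof (rule inj_onI)
      fix x y
      assume xy: "x \<in> {i. i < length la \<and> 0 < row_left la B i}"
        "y \<in> {i. i < length la \<and> 0 < row_left la B i}"
        and e: "row_left la B x = row_left la B y"
      then show "x = y"
        using notin[of x] notin[of y] strict_partition_nth_eq_iff[OF la, of x y]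
        by (simp add: eq split: if_splits)
    qed
  next
    case (type2 i)
    show ?thesis
      using strict_partition_nth_eq_iff[OF la]
      by (auto simp: inj_on_def type2(1) row_left_type2 split: if_splits)
  next
    case (type3 i j)
    show ?thesis
      using strict_partition_nth_eq_iff[OF la]
      by (auto simp: inj_on_def type3(1) row_left_type3 split: if_splits)
  qed
  let ?l = "sort_key (row_left la B) (filter (\<lambda>i. 0 < row_left la B i) [0..<length la])"
  have "sorted (map (row_left la B) ?l)" by simp
  moreover have "distinct (map (row_left la B) ?l)"
    using inj by (auto simp: distinct_map inj_on_def)
  ultimately have "sorted_wrt (<) (map (row_left la B) ?l)"
    by (simp add: strict_sorted_iff)
  then have "sorted_wrt (>) (remove_bar la B)"
    by (simp add: remove_bar_def rows_left_def rev_map[symmetric] sorted_wrt_rev)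
  then show ?thesis
    by (auto simp: strict_partition_def set_remove_bar)
qed

end

(* Only the set S of parts matters: removing a bar replaces a part by a smaller positive integer of
   the other parity that is not in S, or deletes an odd part, or deletes two parts of opposite
   parity. With o odd and e even parts, each such move lowers max o (e + card S mod 2) by at most 1.
   It can always be lowered by exactly 1: if both parities occur, delete a part of each; if all parts
   are odd, delete one; if all are even, replace one by 1. *)

theory Submission
  imports Defs
begin

section \<open>Squares that survive the removal of a bar\<close>

text \<open>Sends a square of the new diagram to the old square whose label it inherits.
  \<open>remove_filling\<close> becomes composition with this map, which separates the geometry of
  removal from the filling.\<close>

definition old_square :: "nat list \<Rightarrow> (nat \<times> nat) set \<Rightarrow> nat \<times> nat \<Rightarrow> nat \<times> nat" where
  "old_square la B = (\<lambda>(p, k). (rows_left la B ! p, rows_left la B ! p + (k - p)))"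

lemma remove_filling_eq: "remove_filling la B T s = T (old_square la B s)"
  by (simp add: remove_filling_def old_square_def split: prod.split)

lemma mem_row_squares: "(x, k) \<in> row_squares la i \<longleftrightarrow> x = i \<and> i \<le> k \<and> k < i + la ! i"
  by (auto simp: row_squares_def)

lemma mem_shifted_diagram:
  "(i, k) \<in> shifted_diagram la \<longleftrightarrow> i < length la \<and> i \<le> k \<and> k < i + la ! i"
  by (auto simp: shifted_diagram_def mem_row_squares)

lemma finite_shifted_diagram: "finite (shifted_diagram la)"
proof -
  have "row_squares la i = Pair i ` {i..<i + la ! i}" for i
    by (auto simp: row_squares_def)
  then show ?thesis
    by (simp add: shifted_diagram_def)
qed

lemma shifted_diagram_Nil [simp]: "shifted_diagram [] = {}"
  by (simp add: shifted_diagram_def)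

lemma bar_subset:
  assumes "is_bar la r B"
  shows "B \<subseteq> shifted_diagram la"
  using assms by cases (auto simp: mem_shifted_diagram mem_row_squares)

lemma bar_nonempty:
  assumes "strict_partition la" "is_bar la r B"
  shows "B \<noteq> {}"
  using assms(2)
proof cases
  case (type1 i j)
  \<comment> \<open>The leftmost removed square of the row; it exists because an odd
    \<open>r\<close> is positive.\<close>
  have "(i, i + (la ! i - r)) \<in> B"
    using type1 by (auto simp: odd_pos)
  then show ?thesis by blast
next
  case (type2 i)
  have "(i, i) \<in> B"
    using type2 by (auto simp: mem_row_squares odd_pos)
  then show ?thesis by blast
next
  case (type3 i j)
  have "(i, i) \<in> B"
    using type3 strict_partition_nth_pos[OF assms(1), of i] by (auto simp: mem_row_squares)
  then show ?thesis by blast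
qed

text \<open>A bar of any type meets each row in a right end, possibly empty or the whole row. So the
  survivors form an initial segment of the row, and the cardinality \<open>row_left\<close> already
  determines them.\<close>

lemma mem_diagram_minus_bar:
  assumes "is_bar la r B"
  shows "(i, k) \<in> shifted_diagram la - B \<longleftrightarrow> i < length la \<and> i \<le> k \<and> k < i + row_left la B i"
  using assms
proof cases
  case (type1 i' j)
  then show ?thesis
    using row_left_type1[of r la i' i] by (auto simp: mem_shifted_diagram)
next
  case (type2 i')
  then show ?thesis
    using row_left_type2[of la i' i] by (auto simp: mem_shifted_diagram mem_row_squares)
next
  case (type3 i' j)
  then show ?thesis
    using row_left_type3[of la i' j i] by (auto simp: mem_shifted_diagram mem_row_squares)
qed

lemma distinct_rows_left: "distinct (rows_left la B)"
  by (simp add: rows_left_def)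

lemma set_rows_left: "set (rows_left la B) = {i. i < length la \<and> 0 < row_left la B i}"
  by (auto simp: rows_left_def)

text \<open>Injective because \<open>rows_left\<close> lists no row twice; onto because it lists
  every row with a surviving square. Hence the labels left after a removal are exactly those of the
  surviving squares.\<close>

lemma bij_betw_old_square:
  assumes "is_bar la r B"
  shows "bij_betw (old_square la B) (shifted_diagram (remove_bar la B)) (shifted_diagram la - B)"
proof -
  let ?R = "rows_left la B" and ?D = "shifted_diagram (remove_bar la B)"
  have D: "(p, k) \<in> ?D \<longleftrightarrow> p < length ?R \<and> p \<le> k \<and> k < p + row_left la B (?R ! p)" for p k
    by (auto simp: mem_shifted_diagram remove_bar_def)
  have inj: "inj_on (old_square la B) ?D"
    using distinct_rows_left[of la B]
    by (auto simp: inj_on_def D old_square_def nth_eq_iff_index_eq)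
  have "old_square la B s \<in> shifted_diagram la - B" if "s \<in> ?D" for s
  proof -
    obtain p k where s: "s = (p, k)"
      by (cases s)
    have "?R ! p \<in> set ?R"
      using that by (simp add: s D)
    then show ?thesis
      using that unfolding s old_square_def prod.case mem_diagram_minus_bar[OF assms]
      by (auto simp: D set_rows_left)
  qed
  moreover have "s \<in> old_square la B ` ?D" if "s \<in> shifted_diagram la - B" for s
  proof -
    obtain i k where s: "s = (i, k)"
      by (cases s)
    have ik: "i < length la" "i \<le> k" "k < i + row_left la B i"
      using that mem_diagram_minus_bar[OF assms] by (auto simp: s)
    then have "i \<in> set ?R"
      by (simp add: set_rows_left)
    then obtain p where p: "p < length ?R" "?R ! p = i"
      by (auto simp: in_set_conv_nth)
    \<comment> \<open>The offset from the start of the row is kept: row \<open>i\<close> starts in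
      column \<open>i\<close>, row \<open>p\<close> in column \<open>p\<close>.\<close>
    then have "(p, p + (k - i)) \<in> ?D" "old_square la B (p, p + (k - i)) = s"
      using ik by (auto simp: D s old_square_def)
    then show ?thesis
      by (metis image_eqI)
  qed
  ultimately show ?thesis
    using inj by (auto simp: bij_betw_def)
qed

lemma remove_filling_image:
  assumes "is_bar la r B"
  shows "remove_filling la B T ` shifted_diagram (remove_bar la B) = T ` (shifted_diagram la - B)"
proof -
  have "remove_filling la B T ` shifted_diagram (remove_bar la B) =
      T ` old_square la B ` shifted_diagram (remove_bar la B)"
    by (simp add: image_image remove_filling_eq)
  then show ?thesis
    using bij_betw_old_square[OF assms] by (simp add: bij_betw_def)
qed

section \<open>Removing and adding one bar of a tableau\<close>

lemma num_bars_remove_bar: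
  assumes "strict_partition la" "is_bar la r B"
    and B: "B = {s \<in> shifted_diagram la. T s = m}"
  shows "num_bars la T = Suc (num_bars (remove_bar la B) (remove_filling la B T))"
proof -
  \<comment> \<open>A bar is nonempty, so the label \<open>m\<close> really occurs and is lost by
    the removal.\<close>
  have "T ` shifted_diagram la = insert m (T ` (shifted_diagram la - B))"
    using bar_nonempty[OF assms(1,2)] B by auto
  moreover have "m \<notin> T ` (shifted_diagram la - B)"
    using B by auto
  ultimately show ?thesis
    by (simp add: num_bars_def remove_filling_image[OF assms(2)] finite_shifted_diagram)
qed

text \<open>Fillings are total functions, so after a bar is added and removed again the filling is
  recovered only on the diagram. This lemma bridges the gap.\<close>

lemma bar_tableau_cong:
  assumes "bar_tableau la T" "\<And>s. s \<in> shifted_diagram la \<Longrightarrow> T' s = T s"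
  shows "bar_tableau la T'"
  using assms
proof (induction arbitrary: T' rule: bar_tableau.induct)
  case (empty T)
  show ?case by (rule bar_tableau.empty)
next
  case (step la T B r)
  have im: "T' ` shifted_diagram la = T ` shifted_diagram la"
    using step.prems by (rule image_cong[OF refl])
  have "bar_tableau (remove_bar la B) (remove_filling la B T')"
  proof (rule step.IH)
    fix s assume "s \<in> shifted_diagram (remove_bar la B)"
    then have "old_square la B s \<in> shifted_diagram la"
      using bij_betw_old_square[OF step.hyps(4)] by (auto simp: bij_betw_def)
    then show "remove_filling la B T' s = remove_filling la B T s"
      using step.prems by (simp add: remove_filling_eq)
  qed
  moreover have "B = {s \<in> shifted_diagram la. T' s = Max (T' ` shifted_diagram la)}"
    using step.hyps(3) step.prems by (auto simp: im)
  ultimately show ?case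
    using step.hyps step.prems by (intro bar_tableau.step[of la T' B r]) auto
qed

lemma bar_tableau_pos:
  assumes "bar_tableau la T" "s \<in> shifted_diagram la"
  shows "0 < T s"
  using assms by cases auto

text \<open>Inverts a removal: the labels of \<open>T\<close> are carried back along the bijection
  \<open>old_square\<close>, and all of \<open>B\<close> receives one label larger than
  these.\<close>

lemma bar_tableau_extend:
  assumes la: "strict_partition la" "la \<noteq> []" and B: "is_bar la r B"
    and T: "bar_tableau (remove_bar la B) T"
  shows "\<exists>T'. bar_tableau la T' \<and> num_bars la T' = Suc (num_bars (remove_bar la B) T)"
proof -
  let ?D = "shifted_diagram (remove_bar la B)" and ?g = "old_square la B"
  \<comment> \<open>The inserted 0 keeps \<open>Max\<close> meaningful when no square remains;
    \<open>Suc\<close> makes the new label positive and strictly largest.\<close>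
  define m where "m = Suc (Max (insert 0 (T ` ?D)))"
  define T' where "T' = (\<lambda>s. if s \<in> B then m else T (inv_into ?D ?g s))"
  note bij = bij_betw_old_square[OF B]
  have less: "T s < m" if "s \<in> ?D" for s
    using that Max_ge[of "insert 0 (T ` ?D)" "T s"]
    by (simp add: m_def finite_shifted_diagram less_Suc_eq_le del: Max_insert)
  have rf: "remove_filling la B T' s = T s" if "s \<in> ?D" for s
    using that bij by (auto simp: remove_filling_eq T'_def bij_betw_def)
  have inv: "inv_into ?D ?g s \<in> ?D" if "s \<in> shifted_diagram la - B" for s
    using that bij by (metis bij_betw_def inv_into_into)
  have T'_in: "T' s = m" if "s \<in> B" for s
    using that by (simp add: T'_def)
  have T'_out: "0 < T' s \<and> T' s < m" if "s \<in> shifted_diagram la - B" for s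
    using that inv[OF that] less bar_tableau_pos[OF T] by (auto simp: T'_def)
  obtain b where b: "b \<in> B"
    using bar_nonempty[OF la(1) B] by blast
  have "Max (T' ` shifted_diagram la) = m"
  proof (rule Max_eqI)
    show "y \<le> m" if "y \<in> T' ` shifted_diagram la" for y
      using that T'_in T'_out by force
    show "m \<in> T' ` shifted_diagram la"
      using b bar_subset[OF B] T'_in[OF b] by (metis image_eqI subsetD)
  qed (simp add: finite_shifted_diagram)
  moreover have Bm: "B = {s \<in> shifted_diagram la. T' s = m}"
    using bar_subset[OF B] T'_in T'_out by force
  moreover have "\<forall>s\<in>shifted_diagram la. 0 < T' s"
    using T'_in T'_out by (metis DiffI m_def zero_less_Suc)
  moreover have "bar_tableau (remove_bar la B) (remove_filling la B T')"
    using rf by (rule bar_tableau_cong[OF T])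
  ultimately have "bar_tableau la T'"
    using la(2) B by (intro bar_tableau.step[of la T' B r]) auto
  moreover have "num_bars (remove_bar la B) (remove_filling la B T') = num_bars (remove_bar la B) T"
    using rf by (simp add: num_bars_def)
  ultimately show ?thesis
    using num_bars_remove_bar[OF la(1) B Bm] by auto
qed

section \<open>Bar removal on the set of parts\<close>

text \<open>The claimed rank as a function of the set of parts. The intersections have the shape
  that \<open>distinct_length_filter\<close> produces from the list formula.\<close>

definition part_bound :: "nat set \<Rightarrow> nat" where
  "part_bound S = max (card ({x. odd x} \<inter> S)) (card ({x. even x} \<inter> S) + card S mod 2)"

text \<open>Forgets row positions: a bar removal becomes a move on a set, and the oddness of
  \<open>r\<close> survives only as a parity condition on the parts involved.\<close>

lemma is_bar_cases_set:
  assumes la: "strict_partition la" and B: "is_bar la r B"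
  obtains (replace) a c R where "set la = insert a R" "set (remove_bar la B) = insert c R"
      "a \<notin> R" "c \<notin> R" "odd (a + c)"
    | (delete) a where "set la = insert a (set (remove_bar la B))" "a \<notin> set (remove_bar la B)"
      "odd a"
    | (delete_pair) a b where "set la = insert a (insert b (set (remove_bar la B)))"
      "a \<notin> insert b (set (remove_bar la B))" "b \<notin> set (remove_bar la B)" "odd (a + b)"
  using B
proof cases
  case (type1 i j)
  have notin: "la ! i - r \<notin> set la"
    using type1_notin[OF la type1(4,5,6)] by (auto simp: in_set_conv_nth)
  show thesis
  proof (rule replace)
    show "set la = insert (la ! i) (set la - {la ! i})"
      using type1 by auto
    show "set (remove_bar la B) = insert (la ! i - r) (set la - {la ! i})"
      using set_remove_bar_type1[OF la type1(3,5)] type1(1) by simp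
    show "odd (la ! i + (la ! i - r))"
      using type1 by simp
  qed (use notin in auto)
next
  case (type2 i)
  have rm: "set (remove_bar la B) = set la - {la ! i}"
    using set_remove_bar_type2[OF la type2(3)] type2(1) by simp
  show thesis
    using type2(2-4) by (intro delete[of "la ! i"]) (auto simp: rm)
next
  case (type3 i j)
  have "la ! i \<noteq> la ! j"
    using strict_partition_nth_eq_iff[OF la, of i j] type3 by simp
  moreover have rm: "set (remove_bar la B) = set la - {la ! i, la ! j}"
    using set_remove_bar_type3[OF la type3(3,4)] type3(1) by simp
  ultimately show thesis
    using type3(2-5) by (intro delete_pair[of "la ! i" "la ! j"]) (auto simp: rm)
qed

section \<open>Lower bound for the number of bars\<close>

lemma part_bound_remove_bar_le:
  assumes "strict_partition la" "is_bar la r B"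
  shows "part_bound (set la) \<le> Suc (part_bound (set (remove_bar la B)))"
  using assms
proof (cases rule: is_bar_cases_set)
  case (replace a c R)
  have fin: "finite R"
    using replace(1) by (metis finite_insert finite_set)
  show ?thesis
    \<comment> \<open>The number of parts is kept and one part changes parity, so each argument of
      the maximum moves by exactly one.\<close>
    unfolding part_bound_def replace(1,2)
    using replace(3-5) fin by auto
next
  case (delete a)
  show ?thesis
    \<comment> \<open>The odd count drops by one; the even count stays while the parity of the
      length flips.\<close>
    unfolding part_bound_def delete(1)
    using delete(2,3) by (simp add: mod_Suc) linarith
next
  case (delete_pair a b)
  \<comment> \<open>Exactly one of \<open>a\<close> and \<open>b\<close> is odd and the parity of
    the length is kept, so both arguments of the maximum drop by one.\<close>
  have "card (insert a (insert b (set (remove_bar la B)))) mod 2 = card (set (remove_bar la B)) mod 2"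
    using delete_pair(2,3) by simp
  then show ?thesis
    unfolding part_bound_def delete_pair(1)
    using delete_pair(2-4) by auto
qed

lemma part_bound_le_num_bars:
  assumes "bar_tableau la T" "strict_partition la"
  shows "part_bound (set la) \<le> num_bars la T"
  using assms
proof induction
  case (empty T)
  show ?case by (simp add: part_bound_def)
next
  case (step la T B r)
  have "part_bound (set la) \<le> Suc (part_bound (set (remove_bar la B)))"
    using step by (intro part_bound_remove_bar_le)
  also have "\<dots> \<le> Suc (num_bars (remove_bar la B) (remove_filling la B T))"
    using step strict_partition_remove_bar by blast
  also have "\<dots> = num_bars la T"
    using num_bars_remove_bar[OF step.prems step.hyps(4,3)] by simp
  finally show ?case .
qed

section \<open>Upper bound: bars that lower the bound by one\<close>

lemma ex_replace_bar:
  assumes la: "strict_partition la" and a: "a \<in> set la"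
    and c: "c \<notin> set la" "0 < c" "c < a" "odd (a + c)"
  shows "\<exists>r B. is_bar la r B \<and> set (remove_bar la B) = insert c (set la - {a})"
proof -
  obtain i where i: "i < length la" "la ! i = a"
    using a by (auto simp: in_set_conv_nth)
  \<comment> \<open>The maximum of \<open>J\<close> is the last row longer than \<open>c\<close>;
    \<open>c\<close> belongs directly after it, which is the position that type 1 asks for.\<close>
  define J where "J = {j. j < length la \<and> c < la ! j}"
  define j where "j = Max J"
  have "finite J" "i \<in> J"
    using i c by (auto simp: J_def)
  then have j: "j < length la" "c < la ! j"
    using Max_in[of J] unfolding j_def[symmetric] by (auto simp: J_def)
  have "Suc j \<notin> J"
    using Max_ge[OF \<open>finite J\<close>, of "Suc j"] by (auto simp: j_def)
  \<comment> \<open>Past the last row \<open>part\<close> is 0, so the positivity of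
    \<open>c\<close> settles that case; otherwise row \<open>Suc j\<close> is not longer than
    \<open>c\<close>.\<close>
  then have "part la (Suc j) \<noteq> c \<Longrightarrow> part la (Suc j) < c"
    using c(2) by (auto simp: part_def J_def)
  moreover have "part la (Suc j) \<noteq> c"
    using c(1,2) by (auto simp: part_def)
  ultimately have p: "part la (Suc j) + (a - c) < la ! i"
    using i c by simp
  have "is_bar la (a - c) {(i, k) | k. i + (la ! i - (a - c)) \<le> k \<and> k < i + la ! i}"
    using c i j p by (intro type1[of "a - c" i la j]) auto
  then show ?thesis
    using set_remove_bar_type1[OF la i(1) p] i c by auto
qed

lemma ex_delete_bar:
  assumes la: "strict_partition la" and a: "a \<in> set la" "odd a"
  shows "\<exists>r B. is_bar la r B \<and> set (remove_bar la B) = set la - {a}"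
proof -
  obtain i where i: "i < length la" "la ! i = a"
    using a by (auto simp: in_set_conv_nth)
  then show ?thesis
    using set_remove_bar_type2[OF la i(1)] type2[of a i la] a by auto
qed

lemma ex_delete_pair_bar:
  assumes la: "strict_partition la" and ab: "a \<in> set la" "b \<in> set la" "odd (a + b)"
  shows "\<exists>r B. is_bar la r B \<and> set (remove_bar la B) = set la - {a, b}"
proof -
  obtain i j where ij: "i < length la" "la ! i = a" "j < length la" "la ! j = b"
    using ab by (auto simp: in_set_conv_nth)
  then have "i \<noteq> j"
    using ab by auto
  \<comment> \<open>Type 3 wants the row indices in increasing order, but either of \<open>a\<close>
    and \<open>b\<close> may be the larger part.\<close>
  then consider "i < j" | "j < i"
    by linarith
  then show ?thesis
  proof cases
    case 1
    then show ?thesis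
      using set_remove_bar_type3[OF la 1] type3[of "a + b" i j la] ij ab by auto
  next
    case 2
    then show ?thesis
      using set_remove_bar_type3[OF la 2] type3[of "a + b" j i la] ij ab
      by (auto simp: add.commute insert_commute)
  qed
qed

lemma ex_bar_part_bound:
  assumes la: "strict_partition la" "la \<noteq> []"
  shows "\<exists>r B. is_bar la r B \<and> part_bound (set la) = Suc (part_bound (set (remove_bar la B)))"
proof -
  consider (mixed) a b where "a \<in> set la" "b \<in> set la" "odd a" "even b"
    | (all_odd) "\<forall>x\<in>set la. odd x" | (all_even) "\<forall>x\<in>set la. even x"
    by blast
  then show ?thesis
  proof cases
    case mixed
    define R where "R = set la - {a, b}"
    have la_eq: "set la = insert a (insert b R)" and R: "a \<notin> insert b R" "b \<notin> R" "finite R"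
      using mixed by (auto simp: R_def)
    obtain r B where B: "is_bar la r B" "set (remove_bar la B) = R"
      using ex_delete_pair_bar[OF la(1), of a b] mixed by (auto simp: R_def)
    have "card (insert a (insert b R)) mod 2 = card R mod 2"
      using R by simp
    then have "part_bound (set la) = Suc (part_bound R)"
      using mixed R unfolding part_bound_def la_eq by simp
    then show ?thesis
      using B by blast
  next
    case all_odd
    obtain a where a: "a \<in> set la"
      using la(2) by (cases la) auto
    define R where "R = set la - {a}"
    have la_eq: "set la = insert a R" and R: "a \<notin> R" "finite R" and odd: "odd a" "\<forall>x\<in>R. odd x"
      using a all_odd by (auto simp: R_def)
    obtain r B where B: "is_bar la r B" "set (remove_bar la B) = R"
      using ex_delete_bar[OF la(1) a odd(1)] by (auto simp: R_def)
    \<comment> \<open>With only odd parts the second argument of the maximum is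
      \<open>card S mod 2\<close>, which never exceeds \<open>card S\<close>.\<close>
    have "part_bound S = card S" if "\<forall>x\<in>S. odd x" for S
    proof -
      have "{x. odd x} \<inter> S = S" "{x. even x} \<inter> S = {}"
        using that by auto
      then show ?thesis
        by (simp add: part_bound_def)
    qed
    then show ?thesis
      using B la_eq R odd all_odd by (metis card_insert_disjoint)
  next
    case all_even
    obtain a where a: "a \<in> set la"
      using la(2) by (cases la) auto
    define R where "R = set la - {a}"
    have la_eq: "set la = insert a R" and R: "a \<notin> R" "1 \<notin> R" "finite R"
      and even: "even a" "\<forall>x\<in>R. even x"
      using a all_even by (auto simp: R_def)
    have "0 < a" "1 \<notin> set la"
      using all_even la(1) a by (auto simp: strict_partition_def)
    moreover from this have "1 < a"
      using even by (cases "a = 1") auto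
    ultimately obtain r B where B: "is_bar la r B" "set (remove_bar la B) = insert 1 R"
      using ex_replace_bar[OF la(1) a, of 1] even unfolding R_def by auto
    have "{x. even x} \<inter> R = R" "{x. odd x} \<inter> R = {}"
      using even by auto
    \<comment> \<open>The length is unchanged, so the second argument drops by one. It remains at
      least 1, even for empty \<open>R\<close>, so the new odd part 1 does not take over the
      maximum.\<close>
    then have "part_bound (insert a R) = Suc (part_bound (insert 1 R))"
      using R even by (simp add: part_bound_def) presburger
    then show ?thesis
      using B la_eq by metis
  qed
qed

text \<open>The induction runs on the bound itself, because replacing an even part by 1 does not
  shorten the partition.\<close>

lemma ex_bar_tableau_part_bound:
  assumes "strict_partition la"
  shows "\<exists>T. bar_tableau la T \<and> num_bars la T = part_bound (set la)"
  using assms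
proof (induction "part_bound (set la)" arbitrary: la rule: less_induct)
  case less
  show ?case
  proof (cases "la = []")
    case True
    then show ?thesis
      using bar_tableau.empty by (auto simp: num_bars_def part_bound_def)
  next
    case False
    obtain r B where B: "is_bar la r B"
      "part_bound (set la) = Suc (part_bound (set (remove_bar la B)))"
      using ex_bar_part_bound[OF less.prems False] by blast
    obtain T where "bar_tableau (remove_bar la B) T"
      "num_bars (remove_bar la B) T = part_bound (set (remove_bar la B))"
      using less.hyps B(2) strict_partition_remove_bar[OF less.prems B(1)] by auto
    then show ?thesis
      using bar_tableau_extend[OF less.prems False B(1)] B(2) by metis
  qed
qed

theorem mainTheorem1:
  fixes la :: "nat list"
  assumes "strict_partition la"
  shows "srank la =
    max (length (filter odd la)) (length (filter even la) + length la mod 2)"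
proof -
  have "srank la = part_bound (set la)"
    unfolding srank_def
    using ex_bar_tableau_part_bound[OF assms] part_bound_le_num_bars[OF _ assms]
    by (intro Least_equality) auto
  \<comment> \<open>Distinctness turns the cardinalities in \<open>part_bound\<close> into lengths
    of filtered lists.\<close>
  moreover have "distinct la"
    using strict_partition_nth_eq_iff[OF assms] by (simp add: distinct_conv_nth)
  ultimately show ?thesis
    by (simp add: part_bound_def distinct_length_filter distinct_card)
qed

end
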